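(* Fix $M\ge0$ and an admissible vector $w^{\mathrm{est}}$, and let $\lambda\ge0$. The primal-dual algorithm described in the context returns a set $T$ of centers, an assignment $i(j)\in T$ for every $j\in\mathcal D$, and a feasible solution $(\alpha,\beta,\lambda)$ of the dual LP (D$_{M,w^{\mathrm{est}}}$) such that $$3\lambda|T|+\sum_j g_{M,w^{\mathrm{est}}}(3;c_{i(j)j})\le 3\sum_j\alpha_j.$$
   Context: Ordered $k$-median setting: finite metric space $(\mathcal D,\{c_{ij}\})$, $n=|\mathcal D|>k$, weights $w_1\ge\dots\ge w_n\ge0$, $\epsilon>0$. Set $\tilde w_i=w_i$ if $w_i\ge\epsilon w_1/n$ and $\tilde w_i=0$ otherwise. Given $M\ge0$, let $L$ be the largest integer with $\frac{\epsilon M}{n}(1+\epsilon)^L\le M$, and for $r=0,\dots,L$ let $I_r=\bigl(\frac{\epsilon M}{n}(1+\epsilon)^{L-r},\frac{\epsilon M}{n}(1+\epsilon)^{L-r+1}\bigr]$. An admissible $w^{\mathrm{est}}=(w^{\mathrm{est}}_0,\dots,w^{\mathrm{est}}_L)$ is non-increasing with each entry a power of $(1+\epsilon)$ in $[\epsilon\tilde w_1/n,\tilde w_1(1+\epsilon))$. For $d\ge0$, $\gamma\ge1$: $g_{M,w^{\mathrm{est}}}(\gamma;d)=\tilde w_1(1+\epsilon)d$ if $d/\gamma>\frac{\epsilon M}{n}(1+\epsilon)^{L+1}$; $=w^{\mathrm{est}}_r d$ if $d/\gamma\in I_r$; $=0$ if $d/\gamma\le\frac{\epsilon M}{n}$.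 Write $g_{M,w^{\mathrm{est}}}(d)=g_{M,w^{\mathrm{est}}}(1;d)$. Dual LP (D$_{M,w^{\mathrm{est}}}$): maximize $\sum_j\alpha_j-k\lambda$ s.t. $\alpha_j\le g_{M,w^{\mathrm{est}}}(c_{ij})+\beta_{ij}$ $\forall i,j$, $\sum_j\beta_{ij}\le\lambda$ $\forall i$, $\alpha,\lambda\ge0$. Algorithm for fixed $\lambda$: (1) Dual ascent: all clients active, $\alpha=\beta=0$, $F=\emptyset$; $j$ reaches $i$ if $\alpha_j\ge g_{M,w^{\mathrm{est}}}(c_{ij})$. Until no client is active, raise uniformly $\alpha_j$ for active $j$ and $\beta_{ij}$ for pairs with $i\notin F$, $j$ active and reaching $i$, until: (a) some client newly reaches some $i\in F$, then it is frozen (made inactive); or (b) $\sum_j\beta_{ij}=\lambda$ for some $i\notin F$, then $i$ joins $F$ and every active client reaching $i$ is frozen. (2) Pruning: choose a maximal $T\subseteq F$ such that each $j$ has at most one $i\in T$ with $\beta_{ij}>0$. (3) Return $T$; $i(j)$ is the point of $T$ nearest to $j$. *)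

theory Defs
  imports "HOL-Analysis.Analysis"
begin

definition trunc_weight :: "real \<Rightarrow> nat \<Rightarrow> (nat \<Rightarrow> real) \<Rightarrow> nat \<Rightarrow> real" where
  "trunc_weight \<epsilon> n w i = (if w i \<ge> \<epsilon> * w 1 / real n then w i else 0)"

text \<open>
  The exponent ranges over the integers: for \<open>\<epsilon> > n\<close> the largest one is \<open>-1\<close>, and then there are
  no intervals and no estimated weights. For \<open>M = 0\<close> every exponent satisfies the inequality, so no
  largest one exists; but all intervals are then empty and the cost function below does not depend
  on \<open>L\<close>.
\<close>
definition is_largest_exponent :: "real \<Rightarrow> real \<Rightarrow> nat \<Rightarrow> int \<Rightarrow> bool" where
  "is_largest_exponent \<epsilon> M n L \<longleftrightarrow>
     \<epsilon> * M / real n * (1 + \<epsilon>) powi L \<le> M \<and>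
     (\<forall>l. \<epsilon> * M / real n * (1 + \<epsilon>) powi l \<le> M \<longrightarrow> l \<le> L)"

definition dist_interval :: "real \<Rightarrow> real \<Rightarrow> nat \<Rightarrow> int \<Rightarrow> int \<Rightarrow> real set" where
  "dist_interval \<epsilon> M n L r =
     {\<epsilon> * M / real n * (1 + \<epsilon>) powi (L - r) <.. \<epsilon> * M / real n * (1 + \<epsilon>) powi (L - r + 1)}"

definition admissible ::
    "real \<Rightarrow> nat \<Rightarrow> (nat \<Rightarrow> real) \<Rightarrow> int \<Rightarrow> (int \<Rightarrow> real) \<Rightarrow> bool" where
  "admissible \<epsilon> n w L west \<longleftrightarrow>
     antimono_on {0..L} west \<and>
     (\<forall>r\<in>{0..L}. (\<exists>m::int. west r = (1 + \<epsilon>) powi m) \<and>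
        west r \<in> {\<epsilon> * trunc_weight \<epsilon> n w 1 / real n ..< trunc_weight \<epsilon> n w 1 * (1 + \<epsilon>)})"

definition est_cost ::
    "real \<Rightarrow> nat \<Rightarrow> (nat \<Rightarrow> real) \<Rightarrow> real \<Rightarrow> int \<Rightarrow> (int \<Rightarrow> real) \<Rightarrow> real \<Rightarrow> real \<Rightarrow> real" where
  "est_cost \<epsilon> n w M L west \<gamma> d =
     (if d / \<gamma> > \<epsilon> * M / real n * (1 + \<epsilon>) powi (L + 1) then trunc_weight \<epsilon> n w 1 * (1 + \<epsilon>) * d
      else if d / \<gamma> \<le> \<epsilon> * M / real n then 0
      else west (THE r. r \<in> {0..L} \<and> d / \<gamma> \<in> dist_interval \<epsilon> M n L r) * d)"

text \<open>
  Below, \<open>g\<close> is the cost function \<open>est_cost \<epsilon> n w M L west 1\<close>; in \<open>c i j\<close> and \<open>\<beta> i j\<close> the first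
  argument is the facility and the second the client.
\<close>

definition dual_feasible ::
    "'a set \<Rightarrow> ('a \<Rightarrow> 'a \<Rightarrow> real) \<Rightarrow> (real \<Rightarrow> real) \<Rightarrow> ('a \<Rightarrow> real) \<Rightarrow> ('a \<Rightarrow> 'a \<Rightarrow> real) \<Rightarrow> real \<Rightarrow> bool"
  where
  "dual_feasible D c g \<alpha> \<beta> lam \<longleftrightarrow>
     (\<forall>i\<in>D. \<forall>j\<in>D. \<alpha> j \<le> g (c i j) + \<beta> i j) \<and>
     (\<forall>i\<in>D. (\<Sum>j\<in>D. \<beta> i j) \<le> lam) \<and>
     (\<forall>j\<in>D. 0 \<le> \<alpha> j) \<and> 0 \<le> lam"

record 'a ascent_state =
  active :: "'a set"
  alpha :: "'a \<Rightarrow> real"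
  beta :: "'a \<Rightarrow> 'a \<Rightarrow> real"
  opened :: "'a set"

definition init_state :: "'a set \<Rightarrow> 'a ascent_state" where
  "init_state D = \<lparr>active = D, alpha = (\<lambda>_. 0), beta = (\<lambda>_ _. 0), opened = {}\<rparr>"

definition reaches ::
    "('a \<Rightarrow> 'a \<Rightarrow> real) \<Rightarrow> (real \<Rightarrow> real) \<Rightarrow> 'a ascent_state \<Rightarrow> 'a \<Rightarrow> 'a \<Rightarrow> bool" where
  "reaches c g s j i \<longleftrightarrow> alpha s j \<ge> g (c i j)"

text \<open>
  Uniform growth for a duration \<open>\<delta>\<close>. The client \<open>j\<close> may start to reach an unopened \<open>i\<close> only during
  that period, and \<open>\<beta> i j\<close> grows from that moment on: it increases by the length of the part of
  \<open>[\<alpha> j, \<alpha> j + \<delta>]\<close> that lies above \<open>g (c i j)\<close>.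
\<close>
definition raise_duals ::
    "'a set \<Rightarrow> ('a \<Rightarrow> 'a \<Rightarrow> real) \<Rightarrow> (real \<Rightarrow> real) \<Rightarrow> real \<Rightarrow> 'a ascent_state \<Rightarrow> 'a ascent_state"
  where
  "raise_duals D c g \<delta> s = s\<lparr>
     alpha := (\<lambda>j. if j \<in> active s then alpha s j + \<delta> else alpha s j),
     beta := (\<lambda>i j. if i \<in> D - opened s \<and> j \<in> active s
                    then beta s i j + max 0 (alpha s j + \<delta> - max (alpha s j) (g (c i j)))
                    else beta s i j)\<rparr>"

text \<open>
  Every active client reaching \<open>i\<close> is frozen at the moment \<open>i\<close> is opened, so an active client that
  reaches an opened \<open>i\<close> has only just come to reach it.
\<close>
definition hits ::
    "('a \<Rightarrow> 'a \<Rightarrow> real) \<Rightarrow> (real \<Rightarrow> real) \<Rightarrow> 'a ascent_state \<Rightarrow> 'a \<Rightarrow> 'a \<Rightarrow> bool" where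
  "hits c g s j i \<longleftrightarrow> j \<in> active s \<and> i \<in> opened s \<and> reaches c g s j i"

definition fully_paid :: "'a set \<Rightarrow> real \<Rightarrow> 'a ascent_state \<Rightarrow> 'a \<Rightarrow> bool" where
  "fully_paid D lam s i \<longleftrightarrow> i \<in> D - opened s \<and> (\<Sum>j\<in>D. beta s i j) = lam"

definition event ::
    "'a set \<Rightarrow> ('a \<Rightarrow> 'a \<Rightarrow> real) \<Rightarrow> (real \<Rightarrow> real) \<Rightarrow> real \<Rightarrow> 'a ascent_state \<Rightarrow> bool" where
  "event D c g lam s \<longleftrightarrow> (\<exists>j i. hits c g s j i) \<or> (\<exists>i. fully_paid D lam s i)"

definition raised_to_event ::
    "'a set \<Rightarrow> ('a \<Rightarrow> 'a \<Rightarrow> real) \<Rightarrow> (real \<Rightarrow> real) \<Rightarrow> real \<Rightarrow> 'a ascent_state \<Rightarrow> 'a ascent_state \<Rightarrow> bool"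
  where
  "raised_to_event D c g lam s s' \<longleftrightarrow>
     (\<exists>\<delta>\<ge>0. s' = raise_duals D c g \<delta> s \<and> event D c g lam s' \<and>
        (\<forall>\<delta>'. 0 \<le> \<delta>' \<and> \<delta>' < \<delta> \<longrightarrow> \<not> event D c g lam (raise_duals D c g \<delta>' s)))"

text \<open>
  One step raises the duals up to the first event and handles one event. Simultaneous events are
  handled one after the other, in any order, by steps with \<open>\<delta> = 0\<close>.
\<close>
inductive ascent_step ::
    "'a set \<Rightarrow> ('a \<Rightarrow> 'a \<Rightarrow> real) \<Rightarrow> (real \<Rightarrow> real) \<Rightarrow> real \<Rightarrow> 'a ascent_state \<Rightarrow> 'a ascent_state \<Rightarrow> bool"
  for D c g lam where
  freeze: "\<lbrakk>active s \<noteq> {}; raised_to_event D c g lam s s'; hits c g s' j i\<rbrakk>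
    \<Longrightarrow> ascent_step D c g lam s (s'\<lparr>active := active s' - {j}\<rparr>)"
| open_facility: "\<lbrakk>active s \<noteq> {}; raised_to_event D c g lam s s'; fully_paid D lam s' i\<rbrakk>
    \<Longrightarrow> ascent_step D c g lam s
          (s'\<lparr>opened := insert i (opened s'), active := active s' - {j. reaches c g s' j i}\<rparr>)"

definition ascent_reachable ::
    "'a set \<Rightarrow> ('a \<Rightarrow> 'a \<Rightarrow> real) \<Rightarrow> (real \<Rightarrow> real) \<Rightarrow> real \<Rightarrow> 'a ascent_state \<Rightarrow> bool" where
  "ascent_reachable D c g lam s \<longleftrightarrow> (ascent_step D c g lam)\<^sup>*\<^sup>* (init_state D) s"

definition conflict_free :: "'a set \<Rightarrow> ('a \<Rightarrow> 'a \<Rightarrow> real) \<Rightarrow> 'a set \<Rightarrow> bool" where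
  "conflict_free D \<beta> T \<longleftrightarrow> (\<forall>j\<in>D. \<exists>\<^sub>\<le>\<^sub>1 i. i \<in> T \<and> \<beta> i j > 0)"

definition pruned :: "'a set \<Rightarrow> ('a \<Rightarrow> 'a \<Rightarrow> real) \<Rightarrow> 'a set \<Rightarrow> 'a set \<Rightarrow> bool" where
  "pruned D \<beta> F T \<longleftrightarrow> T \<subseteq> F \<and> conflict_free D \<beta> T \<and>
     (\<forall>T'. T \<subset> T' \<and> T' \<subseteq> F \<longrightarrow> \<not> conflict_free D \<beta> T')"

definition nearest_assignment ::
    "'a set \<Rightarrow> ('a \<Rightarrow> 'a \<Rightarrow> real) \<Rightarrow> 'a set \<Rightarrow> ('a \<Rightarrow> 'a) \<Rightarrow> bool" where
  "nearest_assignment D c T \<phi> \<longleftrightarrow> (\<forall>j\<in>D. is_arg_min (\<lambda>i. c i j) (\<lambda>i. i \<in> T) (\<phi> j))"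

definition primal_dual_output ::
    "'a set \<Rightarrow> ('a \<Rightarrow> 'a \<Rightarrow> real) \<Rightarrow> (real \<Rightarrow> real) \<Rightarrow> real \<Rightarrow>
     'a set \<Rightarrow> ('a \<Rightarrow> 'a) \<Rightarrow> ('a \<Rightarrow> real) \<Rightarrow> ('a \<Rightarrow> 'a \<Rightarrow> real) \<Rightarrow> bool" where
  "primal_dual_output D c g lam T \<phi> \<alpha> \<beta> \<longleftrightarrow>
     (\<exists>s. ascent_reachable D c g lam s \<and> active s = {} \<and> \<alpha> = alpha s \<and> \<beta> = beta s \<and>
        pruned D \<beta> (opened s) T \<and> nearest_assignment D c T \<phi>)"

text \<open>
  Every run of the dual ascent is finite and gets stuck only when no client is active, and every
  final state admits a pruned set together with a nearest-centre assignment.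
\<close>
definition primal_dual_terminates ::
    "'a set \<Rightarrow> ('a \<Rightarrow> 'a \<Rightarrow> real) \<Rightarrow> (real \<Rightarrow> real) \<Rightarrow> real \<Rightarrow> bool" where
  "primal_dual_terminates D c g lam \<longleftrightarrow>
     termip (ascent_step D c g lam) (init_state D) \<and>
     (\<forall>s. ascent_reachable D c g lam s \<longrightarrow>
        (if active s \<noteq> {} then \<exists>s'. ascent_step D c g lam s s'
         else \<exists>T \<phi>. pruned D (beta s) (opened s) T \<and> nearest_assignment D c T \<phi>))"

end

theory Submission imports Defs begin

text \<open>
  Scaling gives \<open>g (3; d) = 3 * g (d / 3)\<close>, and since the estimated weights decrease with the index,
  \<open>g\<close> is monotone with \<open>g 0 = 0\<close>; nothing else about \<open>g\<close> matters. Throughout the ascent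
  \<open>\<beta> i j = max 0 (\<alpha> j - g (c i j))\<close>, since no client remains active beyond the value at which it
  reaches an opened facility; this gives dual feasibility.

  For the cost bound it suffices that \<open>3 * (\<Sum>i\<in>T. \<beta> i j) + 3 * g (c (\<phi> j) j / 3) \<le> 3 * \<alpha> j\<close> for
  every client \<open>j\<close>. If \<open>\<beta> i j > 0\<close> for a (unique) \<open>i \<in> T\<close>, this is the invariant. Otherwise \<open>j\<close> was
  frozen by some opened \<open>i\<close>, and if \<open>i \<notin> T\<close>, then maximality of \<open>T\<close> yields a client \<open>j'\<close> paying for
  both \<open>i\<close> and some \<open>i' \<in> T\<close>. As \<open>j'\<close> stopped no later than \<open>j\<close>, each leg of the path
  \<open>j, i, j', i'\<close> has cost at most \<open>\<alpha> j\<close>, and a third of \<open>c i' j\<close> is at most the longest leg.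
\<close>

section \<open>The estimated cost function\<close>

lemma est_cost_scale:
  assumes "\<gamma> > 0"
  shows "est_cost \<epsilon> n w M L west \<gamma> d = \<gamma> * est_cost \<epsilon> n w M L west 1 (d / \<gamma>)"
  using assms by (simp add: est_cost_def)

text \<open>The exponent \<open>-1\<close> satisfies the inequality because \<epsilon> \<le> n * (1
  + \<epsilon>), so the largest exponent cannot lie below it. This puts the upper threshold of
  \<open>est_cost\<close> at or above the lower one, even when there are no intervals.\<close>

lemma largest_exponent_ge:
  assumes "is_largest_exponent \<epsilon> M n L" "M > 0" "\<epsilon> > 0" "n > 0"
  shows "-1 \<le> L"
proof -
  have "\<epsilon> * M \<le> M * (real n * (1 + \<epsilon>))"
  proof -
    have "\<epsilon> \<le> 1 * (1 + \<epsilon>)" by simp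
    also have "\<dots> \<le> real n * (1 + \<epsilon>)"
      using assms by (intro mult_right_mono) auto
    finally show ?thesis using assms by (simp add: mult.commute)
  qed
  moreover have "real n * (1 + \<epsilon>) > 0" using assms by simp
  ultimately have "\<epsilon> * M / (real n * (1 + \<epsilon>)) \<le> M"
    by (simp only: pos_divide_le_eq)
  then have "\<epsilon> * M / real n * (1 + \<epsilon>) powi (-1) \<le> M"
    by (simp add: power_int_minus inverse_eq_divide)
  then show ?thesis
    using assms(1) unfolding is_largest_exponent_def by blast
qed

text \<open>The intervals are numbered from the far end, so indices fall as distances grow. With
  \<open>x = y\<close>, applied in both directions, this makes the \<open>THE\<close> in
  \<open>est_cost\<close> unique.\<close>

lemma dist_interval_disjoint:
  assumes "x \<in> dist_interval \<epsilon> M n L r" "y \<in> dist_interval \<epsilon> M n L r'" "x \<le> y"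
    and "\<epsilon> > 0" "M \<ge> 0"
  shows "r' \<le> r"
proof (rule ccontr)
  assume "\<not> r' \<le> r"
  then have "(1 + \<epsilon>) powi (L - r' + 1) \<le> (1 + \<epsilon>) powi (L - r)"
    using \<open>\<epsilon> > 0\<close> by (intro power_int_increasing) auto
  then have "\<epsilon> * M / real n * (1 + \<epsilon>) powi (L - r' + 1) \<le> \<epsilon> * M / real n * (1 + \<epsilon>) powi (L - r)"
    using assms by (intro mult_left_mono) auto
  then show False
    using assms(1-3) by (auto simp: dist_interval_def)
qed

lemma dist_interval_cover:
  assumes "\<epsilon> > 0" "M > 0" "n > 0"
    and "\<epsilon> * M / real n < x" "x \<le> \<epsilon> * M / real n * (1 + \<epsilon>) powi (L + 1)"
  shows "\<exists>r\<in>{0..L}. x \<in> dist_interval \<epsilon> M n L r"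
proof -
  define A where "A = \<epsilon> * M / real n"
  have A: "A > 0" using assms by (simp add: A_def)
  \<comment> \<open>The exponent of the right endpoint of the interval around \<open>x\<close>: the
    ceiling gives (1 + \<epsilon>)^(q - 1) < x / A \<le> (1 + \<epsilon>)^q. Its index
    \<open>r\<close> solves \<open>L - r + 1 = q\<close>.\<close>
  define q where "q = \<lceil>log (1 + \<epsilon>) (x / A)\<rceil>"
  have x: "x / A > 1" using A assms(4) by (simp add: A_def[symmetric])
  have b: "1 + \<epsilon> > 1" using assms by simp
  have powi: "(1 + \<epsilon>) powi m = (1 + \<epsilon>) powr of_int m" for m
    using b by (intro powr_real_of_int'[symmetric]) auto
  have log_pos: "log (1 + \<epsilon>) (x / A) > 0" using x b by simp
  have "x / A \<le> (1 + \<epsilon>) powi (L + 1)"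
    using A assms by (simp add: A_def divide_simps mult.commute)
  also have "\<dots> = (1 + \<epsilon>) powr of_int (L + 1)" by (rule powi)
  finally have "log (1 + \<epsilon>) (x / A) \<le> of_int (L + 1)"
    using x b log_le_iff[of "1 + \<epsilon>" "x / A" "of_int (L + 1)"] by simp
  then have q: "q \<le> L + 1" "q \<ge> 1"
    using log_pos unfolding q_def by linarith+
  have "x / A \<le> (1 + \<epsilon>) powi q"
    using x b unfolding q_def powi by (subst log_le_iff[symmetric]) auto
  moreover have "(1 + \<epsilon>) powi (q - 1) < x / A"
    using x b unfolding q_def powi by (subst less_log_iff[symmetric]) (auto, linarith)
  ultimately have "x \<in> dist_interval \<epsilon> M n L (L + 1 - q)"
    using A unfolding dist_interval_def A_def[symmetric] by (simp add: field_simps)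
  with q show ?thesis by (intro bexI[of _ "L + 1 - q"]) auto
qed

text \<open>Each branch is a weight times the distance. The weight starts at 0, passes through the
  estimated weights in non-decreasing order, and ends at \<open>W\<close>, which bounds them
  all.\<close>

lemma est_cost_mono:
  fixes west :: "int \<Rightarrow> real"
  assumes "\<epsilon> > 0" "M \<ge> 0" "n > 0" "w 1 \<ge> 0"
    and "M > 0 \<longrightarrow> is_largest_exponent \<epsilon> M n L" "admissible \<epsilon> n w L west"
    and "0 \<le> x" "x \<le> y"
  shows "est_cost \<epsilon> n w M L west 1 x \<le> est_cost \<epsilon> n w M L west 1 y"
proof -
  define A where "A = \<epsilon> * M / real n"
  define B where "B = A * (1 + \<epsilon>) powi (L + 1)"
  define W where "W = trunc_weight \<epsilon> n w 1 * (1 + \<epsilon>)"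
  define idx where "idx = (\<lambda>x. THE r. r \<in> {0..L} \<and> x \<in> dist_interval \<epsilon> M n L r)"
  have g: "est_cost \<epsilon> n w M L west 1 z = (if z > B then W * z else if z \<le> A then 0 else west (idx z) * z)"
    for z by (simp add: est_cost_def A_def B_def W_def idx_def)
  have W0: "W \<ge> 0"
    using assms by (auto simp: W_def trunc_weight_def)
  have west: "0 \<le> west r" "west r \<le> W" if "r \<in> {0..L}" for r
  proof -
    have *: "west r \<in> {\<epsilon> * trunc_weight \<epsilon> n w 1 / real n ..< W}"
      using assms(6) that unfolding admissible_def W_def by blast
    have "0 \<le> \<epsilon> * trunc_weight \<epsilon> n w 1 / real n"
      using assms by (auto simp: trunc_weight_def)
    with * show "0 \<le> west r" "west r \<le> W" by auto
  qed
  have idx: "idx z \<in> {0..L}" "z \<in> dist_interval \<epsilon> M n L (idx z)" if z: "A < z" "z \<le> B" for z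
  proof -
    \<comment> \<open>For \<open>M = 0\<close> both thresholds are 0, which leaves no room for
      \<open>z\<close>.\<close>
    have "M > 0"
      using z assms(2) by (cases "M = 0") (simp_all add: A_def B_def)
    then obtain r where r: "r \<in> {0..L}" "z \<in> dist_interval \<epsilon> M n L r"
      using dist_interval_cover[of \<epsilon> M n z L] assms(1,3) z unfolding A_def B_def by blast
    have "r' = r" if "z \<in> dist_interval \<epsilon> M n L r'" for r'
      using dist_interval_disjoint[OF that r(2) order_refl assms(1,2)]
        dist_interval_disjoint[OF r(2) that order_refl assms(1,2)] by simp
    with r have "idx z = r"
      unfolding idx_def by (intro the_equality) blast+
    with r show "idx z \<in> {0..L}" "z \<in> dist_interval \<epsilon> M n L (idx z)" by simp_all
  qed
  \<comment> \<open>\<open>est_cost\<close> tests the upper threshold first, so distances up to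
    \<open>A\<close> cost 0 only if the thresholds come in this order.\<close>
  have AB: "A \<le> B"
  proof (cases "M = 0")
    case False
    then have "-1 \<le> L" using largest_exponent_ge assms by simp
    then have "(1 + \<epsilon>) powi (L + 1) \<ge> 1"
      using assms by (intro one_le_power_int) auto
    moreover have "A \<ge> 0" using assms by (simp add: A_def)
    ultimately show ?thesis
      unfolding B_def using mult_left_mono by fastforce
  qed (simp add: A_def B_def)
  consider "x \<le> A" | "A < x" "y \<le> B" | "A < x" "x \<le> B" "B < y" | "B < x" by linarith
  then show ?thesis
  proof cases
    case 1
    then have "est_cost \<epsilon> n w M L west 1 x = 0"
      using AB by (simp add: g)
    moreover have "0 \<le> est_cost \<epsilon> n w M L west 1 y"
      unfolding g using W0 west(1)[OF idx(1)] assms by (auto intro: mult_nonneg_nonneg)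
    ultimately show ?thesis by simp
  next
    case 2
    with assms(8) have x: "A < x" "x \<le> B" and y: "A < y" "y \<le> B" by auto
    have "idx y \<le> idx x"
      using dist_interval_disjoint idx(2) x y assms by blast
    then have "west (idx x) \<le> west (idx y)"
      using assms(6) idx(1)[OF x] idx(1)[OF y] unfolding admissible_def monotone_on_def by blast
    then show ?thesis
      using x y assms(7,8) west(1)[OF idx(1)[OF y]] by (simp add: g mult_mono)
  next
    case 3
    then show ?thesis
      using assms(7,8) west[OF idx(1), of x] by (simp add: g mult_mono)
  next
    case 4
    then show ?thesis using W0 assms(8) by (simp add: g mult_left_mono)
  qed
qed

section \<open>The dual ascent\<close>

lemma raise_duals_simps [simp]:
  "active (raise_duals D c g \<delta> s) = active s"
  "opened (raise_duals D c g \<delta> s) = opened s"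
  "alpha (raise_duals D c g \<delta> s) j = (if j \<in> active s then alpha s j + \<delta> else alpha s j)"
  "beta (raise_duals D c g \<delta> s) i j =
     (if i \<in> D - opened s \<and> j \<in> active s
      then beta s i j + max 0 (alpha s j + \<delta> - max (alpha s j) (g (c i j))) else beta s i j)"
  by (simp_all add: raise_duals_def)

locale dual_ascent = Metric_space D c
  for D :: "'a set" and c :: "'a \<Rightarrow> 'a \<Rightarrow> real" +
  fixes g :: "real \<Rightarrow> real" and lam :: real
  assumes finite_D: "finite D"
    and D_nonempty: "D \<noteq> {}"
    and g_mono: "\<And>x y. 0 \<le> x \<Longrightarrow> x \<le> y \<Longrightarrow> g x \<le> g y"
    and g_0: "g 0 = 0"
    and lam_nonneg: "0 \<le> lam"
begin

lemma g_nonneg: "0 \<le> x \<Longrightarrow> 0 \<le> g x"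
  using g_mono[of 0 x] g_0 by simp

abbreviation "raise \<equiv> raise_duals D c g"

text \<open>
  In \<open>frozen\<close>, the bound on \<open>\<alpha> j'\<close> expresses that \<open>j\<close> was frozen no earlier than \<open>i\<close> was opened,
  whereas the clients paying for \<open>i\<close> were frozen no later than that.
\<close>
definition ascent_inv :: "'a ascent_state \<Rightarrow> bool" where
  "ascent_inv s \<longleftrightarrow> active s \<subseteq> D \<and> opened s \<subseteq> D \<and>
     (\<forall>j\<in>D. 0 \<le> alpha s j) \<and>
     (\<forall>j\<in>active s. \<forall>j'\<in>D. alpha s j' \<le> alpha s j) \<and>
     (\<forall>i\<in>D. \<forall>j\<in>D. beta s i j = max 0 (alpha s j - g (c i j))) \<and>
     (\<forall>i\<in>opened s. \<forall>j\<in>active s. alpha s j \<le> g (c i j)) \<and>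
     (\<forall>i\<in>D. (\<Sum>j\<in>D. beta s i j) \<le> lam) \<and>
     (\<forall>i\<in>opened s. (\<Sum>j\<in>D. beta s i j) = lam) \<and>
     (\<forall>j\<in>D - active s. \<exists>i\<in>opened s. g (c i j) \<le> alpha s j \<and>
        (\<forall>j'\<in>D. beta s i j' > 0 \<longrightarrow> alpha s j' \<le> alpha s j))"

lemma ascent_invD:
  assumes "ascent_inv s"
  shows active_subset: "active s \<subseteq> D"
    and opened_subset: "opened s \<subseteq> D"
    and alpha_nonneg: "j \<in> D \<Longrightarrow> 0 \<le> alpha s j"
    and alpha_le_active: "j \<in> active s \<Longrightarrow> j' \<in> D \<Longrightarrow> alpha s j' \<le> alpha s j"
    and beta_eq: "i \<in> D \<Longrightarrow> j \<in> D \<Longrightarrow> beta s i j = max 0 (alpha s j - g (c i j))"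
    and active_opened: "i \<in> opened s \<Longrightarrow> j \<in> active s \<Longrightarrow> alpha s j \<le> g (c i j)"
    and sum_beta_le: "i \<in> D \<Longrightarrow> (\<Sum>j\<in>D. beta s i j) \<le> lam"
    and sum_beta_opened: "i \<in> opened s \<Longrightarrow> (\<Sum>j\<in>D. beta s i j) = lam"
    and frozen: "j \<in> D \<Longrightarrow> j \<notin> active s \<Longrightarrow> \<exists>i\<in>opened s. g (c i j) \<le> alpha s j \<and>
        (\<forall>j'\<in>D. beta s i j' > 0 \<longrightarrow> alpha s j' \<le> alpha s j)"
  using assms unfolding ascent_inv_def by blast+

lemma ascent_inv_init: "ascent_inv (init_state D)"
proof -
  have "max 0 (- g (c i j)) = 0" for i j
    using g_nonneg[of "c i j"] by simp
  then show ?thesis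
    using lam_nonneg by (simp add: ascent_inv_def init_state_def)
qed

text \<open>The variable is the duration, and each g (c i j) is a constant in it, so the jumps of
  \<open>g\<close> do no harm.\<close>

lemma continuous_sum_beta: "continuous_on S (\<lambda>\<delta>. \<Sum>j\<in>D. beta (raise \<delta> s) i j)"
proof (intro continuous_on_sum)
  fix j
  show "continuous_on S (\<lambda>\<delta>. beta (raise \<delta> s) i j)"
    by (cases "i \<in> D - opened s \<and> j \<in> active s") (auto intro!: continuous_intros)
qed

lemma raise_0: "raise 0 s = s"
  by (rule ascent_state.equality) (auto simp: fun_eq_iff)

text \<open>By the intermediate value theorem, the payments for \<open>i\<close> cannot pass
  \<open>lam\<close> without being equal to it at some moment.\<close>

lemma fully_paid_before:
  assumes "i \<in> D - opened s" "0 \<le> \<delta>"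
    and "(\<Sum>j\<in>D. beta s i j) \<le> lam" "lam \<le> (\<Sum>j\<in>D. beta (raise \<delta> s) i j)"
  obtains \<delta>' where "0 \<le> \<delta>'" "\<delta>' \<le> \<delta>" "fully_paid D lam (raise \<delta>' s) i"
proof -
  have "\<exists>\<delta>'. 0 \<le> \<delta>' \<and> \<delta>' \<le> \<delta> \<and> (\<Sum>j\<in>D. beta (raise \<delta>' s) i j) = lam"
    using assms continuous_sum_beta by (intro IVT') (simp_all only: raise_0)
  then show ?thesis
    using assms(1) that unfolding fully_paid_def by fastforce
qed

lemma ascent_inv_raise:
  assumes inv: "ascent_inv s" and "0 \<le> \<delta>"
    and no_event: "\<And>\<delta>'. 0 \<le> \<delta>' \<Longrightarrow> \<delta>' < \<delta> \<Longrightarrow> \<not> event D c g lam (raise \<delta>' s)"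
  shows "ascent_inv (raise \<delta> s)"
proof -
  note I = ascent_invD[OF inv]
  have opn: "alpha s j + \<delta> \<le> g (c i j)" if "i \<in> opened s" "j \<in> active s" for i j
  proof (rule ccontr)
    assume "\<not> ?thesis"
    \<comment> \<open>The duration after which \<alpha> j equals g (c i j). It is nonnegative by
      \<open>active_opened\<close>, so this hit would precede \<delta>.\<close>
    then have "event D c g lam (raise (g (c i j) - alpha s j) s)" "g (c i j) - alpha s j < \<delta>"
      using that by (force simp: event_def hits_def reaches_def)+
    then show False using no_event I(6)[OF that] by force
  qed
  \<comment> \<open>Payments for an opened facility stay put while \<alpha> may rise. The formula
    survives because, for active \<open>j\<close>, \<open>opn\<close> makes both sides 0.\<close>
  have beta: "beta (raise \<delta> s) i j = max 0 (alpha (raise \<delta> s) j - g (c i j))"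
    if "i \<in> D" "j \<in> D" for i j
    using that I(5)[OF that] \<open>0 \<le> \<delta>\<close> opn[of i j] by (auto simp: max_def)
  have beta_opened: "beta (raise \<delta> s) i j = beta s i j" if "i \<in> opened s" for i j
    using that by simp
  have sum: "(\<Sum>j\<in>D. beta (raise \<delta> s) i j) \<le> lam" if iD: "i \<in> D" for i
  proof (rule ccontr)
    assume *: "\<not> ?thesis"
    then have "i \<in> D - opened s" using I(7)[OF iD] iD by force
    then obtain \<delta>' where d: "0 \<le> \<delta>'" "\<delta>' \<le> \<delta>" "fully_paid D lam (raise \<delta>' s) i"
      using fully_paid_before[of i s \<delta>] I(7)[OF iD] \<open>0 \<le> \<delta>\<close> * by auto
    then have "\<delta>' \<noteq> \<delta>" using * by (auto simp: fully_paid_def simp del: raise_duals_simps)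
    then show False using no_event d unfolding event_def by force
  qed
  have frozen: "\<exists>i\<in>opened s. g (c i j) \<le> alpha (raise \<delta> s) j \<and>
        (\<forall>j'\<in>D. beta (raise \<delta> s) i j' > 0 \<longrightarrow> alpha (raise \<delta> s) j' \<le> alpha (raise \<delta> s) j)"
    if j: "j \<in> D - active s" for j
  proof -
    obtain i where i: "i \<in> opened s" "g (c i j) \<le> alpha s j"
        "\<forall>j'\<in>D. beta s i j' > 0 \<longrightarrow> alpha s j' \<le> alpha s j"
      using I(9) j by blast
    \<comment> \<open>A client paying for \<open>i\<close> has \<alpha> above g (c i j'), which
      \<open>active_opened\<close> excludes for active ones. Hence the payers for \<open>i\<close>
      no longer grow and the old witness stays valid.\<close>
    have "j' \<notin> active s" if "j' \<in> D" "beta s i j' > 0" for j'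
      using that I(5)[of i j'] I(6)[of i j'] I(2) i(1) by force
    then show ?thesis using i j by (intro bexI[of _ i]) auto
  qed
  have "\<forall>j\<in>D. 0 \<le> alpha (raise \<delta> s) j"
    using I(3) \<open>0 \<le> \<delta>\<close> by simp
  moreover have "\<forall>j\<in>active s. \<forall>j'\<in>D. alpha (raise \<delta> s) j' \<le> alpha (raise \<delta> s) j"
    using I(4) \<open>0 \<le> \<delta>\<close> by (auto intro: add_increasing2)
  moreover have "\<forall>i\<in>opened s. \<forall>j\<in>active s. alpha (raise \<delta> s) j \<le> g (c i j)"
    using opn by simp
  moreover have "\<forall>i\<in>opened s. (\<Sum>j\<in>D. beta (raise \<delta> s) i j) = lam"
    using I(8) by (simp add: beta_opened del: raise_duals_simps)
  ultimately show ?thesis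
    unfolding ascent_inv_def raise_duals_simps(1,2)
    using I(1,2) beta sum frozen by blast
qed

text \<open>Until it is frozen, \<open>j\<close> is active and so has the largest \<alpha>. The
  facility that it hits is therefore a witness for \<open>frozen\<close>.\<close>

lemma ascent_inv_freeze:
  assumes inv: "ascent_inv s" and hit: "hits c g s j i"
  shows "ascent_inv (s\<lparr>active := active s - {j}\<rparr>)" (is "ascent_inv ?s")
proof -
  note I = ascent_invD[OF inv]
  have "g (c i j) \<le> alpha s j" "\<forall>j'\<in>D. alpha s j' \<le> alpha s j" "i \<in> opened s"
    using hit I(4) by (auto simp: hits_def reaches_def)
  moreover have eqs: "active ?s = active s - {j}" "opened ?s = opened s"
      "alpha ?s = alpha s" "beta ?s = beta s"
    by simp_all
  ultimately show ?thesis
    using inv unfolding ascent_inv_def eqs by (elim conjE, intro conjI) blast+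
qed

text \<open>The clients frozen here have the largest \<alpha> and get \<open>i\<close> as witness,
  and clients frozen earlier keep theirs. Those still active do not reach \<open>i\<close>, which
  gives the bound on \<alpha> for the new facility.\<close>

lemma ascent_inv_open:
  assumes inv: "ascent_inv s" and paid: "fully_paid D lam s i"
  shows "ascent_inv (s\<lparr>opened := insert i (opened s), active := active s - {j. reaches c g s j i}\<rparr>)"
    (is "ascent_inv ?s")
proof -
  note I = ascent_invD[OF inv]
  have "i \<in> D" "(\<Sum>j\<in>D. beta s i j) = lam"
    using paid by (auto simp: fully_paid_def)
  moreover have "\<forall>j. j \<in> active s \<and> \<not> reaches c g s j i \<longrightarrow> alpha s j \<le> g (c i j)"
    by (auto simp: reaches_def)
  moreover have "\<exists>i'\<in>insert i (opened s). g (c i' j) \<le> alpha s j \<and>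
        (\<forall>j'\<in>D. beta s i' j' > 0 \<longrightarrow> alpha s j' \<le> alpha s j)"
    if "j \<in> D" "j \<notin> active s \<or> reaches c g s j i" for j
  proof (cases "j \<in> active s")
    case True
    then show ?thesis using that I(4) by (auto simp: reaches_def)
  next
    case False
    then show ?thesis using that I(9) by blast
  qed
  moreover have eqs: "active ?s = active s - {j. reaches c g s j i}"
      "opened ?s = insert i (opened s)" "alpha ?s = alpha s" "beta ?s = beta s"
    by simp_all
  ultimately show ?thesis
    using inv unfolding ascent_inv_def eqs by (elim conjE, intro conjI) blast+
qed

lemma raised_to_event_inv:
  assumes "raised_to_event D c g lam s s'" "ascent_inv s"
  shows "ascent_inv s'"
  using assms ascent_inv_raise unfolding raised_to_event_def by blast

lemma raised_to_event_sets:
  assumes "raised_to_event D c g lam s s'"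
  shows "active s' = active s" "opened s' = opened s"
  using assms unfolding raised_to_event_def by auto

lemma ascent_step_inv:
  assumes "ascent_step D c g lam s s'" "ascent_inv s"
  shows "ascent_inv s'"
  using assms
  by cases (blast intro: ascent_inv_freeze ascent_inv_open raised_to_event_inv)+

lemma ascent_reachable_inv:
  assumes "ascent_reachable D c g lam s"
  shows "ascent_inv s"
  using assms unfolding ascent_reachable_def
  by (induction rule: rtranclp_induct) (auto intro: ascent_inv_init ascent_step_inv)

text \<open>Both counts are needed: an opening need not freeze any client, and a freeze opens no
  facility.\<close>

lemma ascent_step_decreases:
  assumes step: "ascent_step D c g lam s s'" and "active s \<subseteq> D"
  shows "active s' \<subseteq> D"
    "card (active s') + card (D - opened s') < card (active s) + card (D - opened s)"
proof -
  have fin: "finite (active s)" "finite (D - opened s)"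
    using assms finite_D finite_subset by auto
  show "active s' \<subseteq> D"
    using assms by cases (auto dest: raised_to_event_sets)
  show "card (active s') + card (D - opened s') < card (active s) + card (D - opened s)"
    using step
  proof cases
    case (freeze s1 j i)
    with raised_to_event_sets[OF freeze(3)] have "j \<in> active s"
      by (simp add: hits_def)
    then show ?thesis
      using freeze raised_to_event_sets[OF freeze(3)] fin card_Diff1_less by fastforce
  next
    case (open_facility s1 i)
    note sets = raised_to_event_sets[OF open_facility(3)]
    have "i \<in> D - opened s"
      using open_facility sets by (simp add: fully_paid_def)
    then have "D - insert i (opened s) \<subset> D - opened s" by blast
    then have "card (D - insert i (opened s)) < card (D - opened s)"
      using fin psubset_card_mono by blast
    moreover have "card (active s - {j. reaches c g s1 j i}) \<le> card (active s)"
      using fin by (intro card_mono) auto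
    ultimately show ?thesis
      using open_facility(1) sets by simp
  qed
qed

lemma ascent_terminates:
  assumes "active s \<subseteq> D"
  shows "termip (ascent_step D c g lam) s"
  using assms
proof (induction "card (active s) + card (D - opened s)" arbitrary: s rule: less_induct)
  case less
  show ?case
    by (rule accpI) (use less ascent_step_decreases in auto)
qed

text \<open>An active client reaches its own location from the start, as g 0 = 0. If that location
  is opened, this is a hit at once; otherwise the client alone pays \<open>lam\<close> for it within
  duration \<open>lam\<close>.\<close>

lemma event_exists:
  assumes inv: "ascent_inv s" and "active s \<noteq> {}"
  obtains \<delta> where "0 \<le> \<delta>" "event D c g lam (raise \<delta> s)"
proof -
  note I = ascent_invD[OF inv]
  obtain j where j: "j \<in> active s" "j \<in> D" using assms(2) I(1) by blast
  have jj: "g (c j j) = 0" using j g_0 by simp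
  show ?thesis
  proof (cases "j \<in> opened s")
    case True
    then have "hits c g s j j"
      using j I(3) jj by (simp add: hits_def reaches_def)
    then show ?thesis
      using that[of 0] by (auto simp: raise_0 event_def)
  next
    case False
    have "lam \<le> beta (raise lam s) j j"
      using False j I(3)[of j] I(5)[of j j] jj lam_nonneg by simp
    also have "\<dots> \<le> (\<Sum>j'\<in>D. beta (raise lam s) j j')"
      using j finite_D I(5) by (intro member_le_sum) auto
    finally show ?thesis
      using fully_paid_before[of j s lam] False j I(7) lam_nonneg that
      unfolding event_def by (metis DiffI)
  qed
qed

text \<open>The set of durations after which an event occurs is closed, so it contains its infimum.\<close>
lemma first_event_exists:
  assumes inv: "ascent_inv s" and "active s \<noteq> {}"
  obtains s' where "raised_to_event D c g lam s s'"
proof -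
  note I = ascent_invD[OF inv]
  define E where "E = {\<delta>. 0 \<le> \<delta> \<and> event D c g lam (raise \<delta> s)}"
  have hit: "hits c g (raise \<delta> s) j i \<longleftrightarrow>
      j \<in> active s \<and> i \<in> opened s \<and> g (c i j) - alpha s j \<le> \<delta>" for \<delta> i j
    by (auto simp: hits_def reaches_def)
  have paid: "fully_paid D lam (raise \<delta> s) i \<longleftrightarrow>
      i \<in> D - opened s \<and> (\<Sum>j\<in>D. beta (raise \<delta> s) i j) = lam" for \<delta> i
    by (simp add: fully_paid_def del: raise_duals_simps(4))
  \<comment> \<open>Each hit contributes a closed half-line of durations, each payment a level set
    of a continuous function, and there are finitely many of both.\<close>
  have "E = {0..} \<inter> ((\<Union>j\<in>active s. \<Union>i\<in>opened s. {g (c i j) - alpha s j..}) \<union>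
      (\<Union>i\<in>D - opened s. {\<delta>. (\<Sum>j\<in>D. beta (raise \<delta> s) i j) = lam}))"
    unfolding E_def event_def hit paid
    by (rule set_eqI, simp only: mem_Collect_eq Int_iff Un_iff UN_iff atLeast_iff, blast)
  moreover have "finite (active s)" "finite (opened s)"
    using I(1,2) finite_D finite_subset by auto
  moreover have "closed {\<delta>. (\<Sum>j\<in>D. beta (raise \<delta> s) i j) = lam}" for i
    by (intro closed_Collect_eq continuous_sum_beta continuous_on_const)
  ultimately have "closed E"
    using finite_D by (auto intro!: closed_Int closed_Un closed_UN simp del: raise_duals_simps(4))
  moreover have "E \<noteq> {}"
    using event_exists[OF assms] unfolding E_def by blast
  moreover have bdd: "bdd_below E"
    by (rule bdd_belowI[of _ 0]) (simp add: E_def)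
  ultimately have "Inf E \<in> E" by (simp add: closed_contains_Inf)
  moreover have "\<not> event D c g lam (raise \<delta>' s)" if "0 \<le> \<delta>'" "\<delta>' < Inf E" for \<delta>'
    using that cInf_lower[OF _ bdd, of \<delta>'] unfolding E_def by force
  ultimately show ?thesis
    using that unfolding raised_to_event_def E_def by blast
qed

lemma ascent_progress:
  assumes "ascent_inv s" "active s \<noteq> {}"
  shows "\<exists>s'. ascent_step D c g lam s s'"
proof -
  obtain s' where s': "raised_to_event D c g lam s s'"
    using first_event_exists[OF assms] .
  then have "event D c g lam s'"
    unfolding raised_to_event_def by blast
  then show ?thesis
    using s' assms(2) unfolding event_def by (metis ascent_step.intros)
qed

section \<open>Pruning and the cost bound\<close>

lemma pruned_exists:
  assumes "finite F"
  shows "\<exists>T. pruned D \<beta> F T"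
proof -
  have "finite {T. T \<subseteq> F \<and> conflict_free D \<beta> T}" using assms by simp
  moreover have "{} \<in> {T. T \<subseteq> F \<and> conflict_free D \<beta> T}"
    by (simp add: conflict_free_def Uniq_def)
  ultimately obtain T where "T \<in> {T. T \<subseteq> F \<and> conflict_free D \<beta> T}"
      "\<forall>T'\<in>{T. T \<subseteq> F \<and> conflict_free D \<beta> T}. T \<subseteq> T' \<longrightarrow> T = T'"
    using finite_has_maximal2 by (metis (no_types, lifting))
  then show ?thesis unfolding pruned_def by blast
qed

text \<open>A single facility never conflicts with itself, so the empty set is not maximal.\<close>

lemma pruned_nonempty:
  assumes "pruned D \<beta> F T" "F \<noteq> {}"
  shows "T \<noteq> {}"
proof
  assume "T = {}"
  obtain i where "i \<in> F" using assms(2) by blast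
  moreover have "conflict_free D \<beta> {i}"
    by (simp add: conflict_free_def Uniq_def)
  ultimately show False
    using assms(1) \<open>T = {}\<close> unfolding pruned_def by blast
qed

text \<open>By maximality, adding \<open>i\<close> makes some client pay for two facilities. They
  cannot both lie in \<open>T\<close>, so one of them is \<open>i\<close>.\<close>

lemma pruned_conflict:
  assumes "pruned D \<beta> F T" "i \<in> F" "i \<notin> T"
  obtains j i' where "j \<in> D" "i' \<in> T" "\<beta> i j > 0" "\<beta> i' j > 0"
proof -
  have "T \<subset> insert i T" "insert i T \<subseteq> F" "conflict_free D \<beta> T"
    using assms by (auto simp: pruned_def)
  then have "\<not> conflict_free D \<beta> (insert i T)"
    using assms(1) by (simp add: pruned_def)
  then show ?thesis
    using \<open>conflict_free D \<beta> T\<close> that unfolding conflict_free_def Uniq_def by (metis insert_iff)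
qed

lemma final_opened_nonempty:
  assumes "ascent_inv s" "active s = {}"
  shows "opened s \<noteq> {}"
  using ascent_invD(9)[OF assms(1)] assms(2) D_nonempty by blast

lemma nearest_assignment_exists:
  assumes "finite T" "T \<noteq> {}"
  shows "\<exists>\<phi>. nearest_assignment D c T \<phi>"
proof -
  have "\<exists>i. is_arg_min (\<lambda>i. c i j) (\<lambda>i. i \<in> T) i" for j
    using ex_is_arg_min_if_finite[OF assms] .
  then show ?thesis unfolding nearest_assignment_def by metis
qed

theorem primal_dual_terminates: "primal_dual_terminates D c g lam"
proof -
  have "\<exists>T \<phi>. pruned D (beta s) (opened s) T \<and> nearest_assignment D c T \<phi>"
    if "ascent_inv s" "active s = {}" for s
  proof -
    have fin: "finite (opened s)"
      using ascent_invD(2)[OF that(1)] finite_D finite_subset by blast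
    obtain T where T: "pruned D (beta s) (opened s) T"
      using pruned_exists[OF fin] by blast
    have "T \<noteq> {}" using pruned_nonempty[OF T] final_opened_nonempty[OF that] by blast
    moreover have "finite T" using T fin finite_subset unfolding pruned_def by blast
    ultimately show ?thesis using T nearest_assignment_exists by blast
  qed
  moreover have "termip (ascent_step D c g lam) (init_state D)"
    by (rule ascent_terminates) (simp add: init_state_def)
  ultimately show ?thesis
    unfolding primal_dual_terminates_def using ascent_reachable_inv ascent_progress by auto
qed

lemma client_bound:
  assumes inv: "ascent_inv s" and final: "active s = {}"
    and T: "pruned D (beta s) (opened s) T"
    and \<phi>: "nearest_assignment D c T \<phi>" and j: "j \<in> D"
  shows "(\<Sum>i\<in>T. beta s i j) + g (c (\<phi> j) j / 3) \<le> alpha s j"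
proof -
  note I = ascent_invD[OF inv]
  have TD: "T \<subseteq> D"
    using T I(2) by (auto simp: pruned_def)
  have "finite T"
    using TD finite_D by (rule finite_subset)
  \<comment> \<open>Here \<open>d\<close> stands for a third of an upper bound on the distance to
    some centre. It will be the distance itself, or the longest of three legs.\<close>
  have nearest: "g (c (\<phi> j) j / 3) \<le> g d" if "i \<in> T" "c i j \<le> 3 * d" for i d
  proof -
    have "c (\<phi> j) j \<le> c i j"
      using \<phi> j that(1) unfolding nearest_assignment_def is_arg_min_linorder by blast
    then show ?thesis using that by (intro g_mono) auto
  qed
  have beta_zero: "beta s i j = 0" if "i \<in> T" "\<not> beta s i j > 0" for i
    using that TD I(5)[OF _ j, of i] by fastforce
  show ?thesis
  proof (cases "\<exists>i\<in>T. beta s i j > 0")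
    case True
    then obtain i where i: "i \<in> T" "beta s i j > 0" by blast
    have "beta s i' j = 0" if "i' \<in> T - {i}" for i'
    proof -
      have "\<not> beta s i' j > 0"
        using T j i that unfolding pruned_def conflict_free_def Uniq_def by blast
      then show ?thesis using beta_zero that by blast
    qed
    then have "(\<Sum>i\<in>T. beta s i j) = beta s i j"
      using \<open>finite T\<close> i by (simp add: sum.remove[of T i])
    moreover have "beta s i j = alpha s j - g (c i j)"
      using i I(5)[of i j] TD j by auto
    ultimately show ?thesis using nearest[of i "c i j"] i by simp
  next
    case False
    have "(\<Sum>i\<in>T. beta s i j) = 0"
      using False beta_zero by (intro sum.neutral) blast
    moreover have "g (c (\<phi> j) j / 3) \<le> alpha s j"
    proof -
      obtain i where i: "i \<in> opened s" "g (c i j) \<le> alpha s j"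
          "\<And>j'. j' \<in> D \<Longrightarrow> beta s i j' > 0 \<Longrightarrow> alpha s j' \<le> alpha s j"
        using I(9)[OF j] final by blast
      have iD: "i \<in> D" using i I(2) by blast
      show ?thesis
      proof (cases "i \<in> T")
        case True
        then show ?thesis using nearest[of i "c i j"] i by simp
      next
        case False
        obtain j' i' where j': "j' \<in> D" and i': "i' \<in> T" "beta s i j' > 0" "beta s i' j' > 0"
          using pruned_conflict[OF T i(1) False] .
        have i'D: "i' \<in> D" using i' TD by blast
        \<comment> \<open>A positive payment puts the cost of a leg below \<alpha> j', and \<alpha>
          j' \<le> \<alpha> j because \<open>j'\<close> pays for \<open>i\<close>, the facility that
          froze \<open>j\<close>.\<close>
        have legs: "g (c i j) \<le> alpha s j" "g (c i j') \<le> alpha s j" "g (c i' j') \<le> alpha s j"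
          using i i' I(5)[OF iD j'] I(5)[OF i'D j'] i(3)[OF j'] by linarith+
        have "c i' j \<le> c i' j' + c i j' + c i j"
          using triangle[of i' j' j] triangle[of j' i j] commute[of j' i] j j' iD i'D by simp
        \<comment> \<open>Passing to the longest leg avoids any subadditivity of \<open>g\<close>:
          the value of \<open>g\<close> at the maximum is one of the three bounded values.\<close>
        also have "\<dots> \<le> 3 * max (c i j) (max (c i j') (c i' j'))" by simp
        finally have "g (c (\<phi> j) j / 3) \<le> g (max (c i j) (max (c i j') (c i' j')))"
          using nearest i' by blast
        also have "\<dots> \<le> alpha s j" using legs by (simp add: max_def)
        finally show ?thesis .
      qed
    qed
    ultimately show ?thesis by simp
  qed
qed

theorem primal_dual_output_bound:
  assumes "primal_dual_output D c g lam T \<phi> \<alpha> \<beta>"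
  shows "T \<subseteq> D" "\<forall>j\<in>D. \<phi> j \<in> T" "dual_feasible D c g \<alpha> \<beta> lam"
    "lam * real (card T) + (\<Sum>j\<in>D. g (c (\<phi> j) j / 3)) \<le> (\<Sum>j\<in>D. \<alpha> j)"
proof -
  obtain s where s: "ascent_reachable D c g lam s" "active s = {}" "\<alpha> = alpha s" "\<beta> = beta s"
      "pruned D (beta s) (opened s) T" "nearest_assignment D c T \<phi>"
    using assms unfolding primal_dual_output_def by blast
  have inv: "ascent_inv s" using ascent_reachable_inv s(1) .
  note I = ascent_invD[OF inv]
  have TF: "T \<subseteq> opened s" using s(5) by (simp add: pruned_def)
  then show "T \<subseteq> D" using I(2) by blast
  show "\<forall>j\<in>D. \<phi> j \<in> T"
    using s(6) by (simp add: nearest_assignment_def is_arg_min_def)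
  show "dual_feasible D c g \<alpha> \<beta> lam"
    using I(3,5,7) lam_nonneg unfolding dual_feasible_def s(3,4) by auto
  \<comment> \<open>Every facility of \<open>T\<close> was opened, hence is paid exactly
    \<open>lam\<close>. Swapping the sums charges these payments to the clients, where
    \<open>client_bound\<close> applies.\<close>
  have "lam * real (card T) = (\<Sum>i\<in>T. \<Sum>j\<in>D. beta s i j)"
    using I(8) TF by (simp add: subset_iff mult.commute)
  also have "\<dots> = (\<Sum>j\<in>D. \<Sum>i\<in>T. beta s i j)" by (rule sum.swap)
  finally have "lam * real (card T) + (\<Sum>j\<in>D. g (c (\<phi> j) j / 3)) =
      (\<Sum>j\<in>D. (\<Sum>i\<in>T. beta s i j) + g (c (\<phi> j) j / 3))"
    by (simp add: sum.distrib)
  also have "\<dots> \<le> (\<Sum>j\<in>D. \<alpha> j)"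
    unfolding s(3) using client_bound[OF inv s(2,5,6)] by (intro sum_mono)
  finally show "lam * real (card T) + (\<Sum>j\<in>D. g (c (\<phi> j) j / 3)) \<le> (\<Sum>j\<in>D. \<alpha> j)" .
qed

end

section \<open>Specialisation to the estimated cost function\<close>

theorem theorem5:
  fixes D :: "'a set" and c :: "'a \<Rightarrow> 'a \<Rightarrow> real" and n k :: nat
    and w :: "nat \<Rightarrow> real" and \<epsilon> M lam :: real and L :: int and west :: "int \<Rightarrow> real"
  assumes "Metric_space D c" and "finite D" and "n = card D" and "n > k"
    and "antimono_on {1..n} w" and "\<forall>i\<in>{1..n}. 0 \<le> w i"
    and "\<epsilon> > 0" and "M \<ge> 0"
    and "M > 0 \<longrightarrow> is_largest_exponent \<epsilon> M n L"
    and "admissible \<epsilon> n w L west"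
    and "lam \<ge> 0"
  shows "primal_dual_terminates D c (est_cost \<epsilon> n w M L west 1) lam \<and>
    (\<forall>T \<phi> \<alpha> \<beta>. primal_dual_output D c (est_cost \<epsilon> n w M L west 1) lam T \<phi> \<alpha> \<beta> \<longrightarrow>
       T \<subseteq> D \<and> (\<forall>j\<in>D. \<phi> j \<in> T) \<and>
       dual_feasible D c (est_cost \<epsilon> n w M L west 1) \<alpha> \<beta> lam \<and>
       3 * lam * real (card T) + (\<Sum>j\<in>D. est_cost \<epsilon> n w M L west 3 (c (\<phi> j) j))
         \<le> 3 * (\<Sum>j\<in>D. \<alpha> j))"
proof -
  \<comment> \<open>Since \<open>k\<close> is a natural number, \<open>n > k\<close> makes
    \<open>n\<close> positive. Then \<open>D\<close> is nonempty and index 1 lies in the range of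
    the weights.\<close>
  have n: "n > 0" "w 1 \<ge> 0" using assms(4,6) by auto
  define g where "g = est_cost \<epsilon> n w M L west 1"
  interpret Metric_space D c by fact
  interpret dual_ascent D c g lam
  proof
    show "D \<noteq> {}" using n assms(3) by auto
    show "g x \<le> g y" if "0 \<le> x" "x \<le> y" for x y
      unfolding g_def by (rule est_cost_mono) (use assms n that in auto)
    show "g 0 = 0" by (simp add: g_def est_cost_def)
  qed (use assms in auto)
  \<comment> \<open>The cost with parameter 3 is three times the unscaled cost at a third of the
    distance, so a common factor 3 comes out.\<close>
  have scale: "3 * lam * real (card T) + (\<Sum>j\<in>D. est_cost \<epsilon> n w M L west 3 (c (\<phi> j) j))
      = 3 * (lam * real (card T) + (\<Sum>j\<in>D. g (c (\<phi> j) j / 3)))" for T :: "'a set" and \<phi>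
    by (simp add: est_cost_scale[of 3] g_def sum_distrib_left distrib_left)
  have cost_bound: "3 * lam * real (card T) + (\<Sum>j\<in>D. est_cost \<epsilon> n w M L west 3 (c (\<phi> j) j))
      \<le> 3 * (\<Sum>j\<in>D. \<alpha> j)" if "primal_dual_output D c g lam T \<phi> \<alpha> \<beta>" for T \<phi> \<alpha> \<beta>
    unfolding scale by (rule mult_left_mono[OF primal_dual_output_bound(4)[OF that]]) simp
  show ?thesis
    unfolding g_def[symmetric]
    by (intro conjI allI impI primal_dual_terminates)
      (erule primal_dual_output_bound(1-3) cost_bound)+
qed

end
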